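(* Consider the Simplex table associated with a base $B$ of the dual linear program $(D)$, let $(\tau_j)$ be a constraint plane, $j\in\{1,\dots,n+m\}$, let $\tau_j=(\tau_{1j},\dots,\tau_{mj})^T$ be its norm vector in this table and $c^{\wedge}_j$ its cutting degree with respect to the cone vertex $V$. (1) If $\tau_j\ge 0$ (i.e. $\tau_{ij}\ge 0$ for all $i=1,\dots,m$) and $c^{\wedge}_j<0$, then the plane $(\tau_j)$ is eliminatable. (2) If $\tau_j\le 0$ (i.e. $\tau_{ij}\le 0$ for all $i=1,\dots,m$) and $c^{\wedge}_j>0$, then $(\tau_j)$ cuts off all feasible points.
   Context: Let $A\in\mathbb{R}^{m\times n}$, let $b\in\mathbb{R}^m$ be a column vector with $b\ge 0$ (standing assumption), and let $c\in\mathbb{R}^n$ be a row vector. The primal problem is $\max\{cx\mid Ax\le b\}$ and the dual problem is $(D)$: $\min\{yb\mid yA\ge c,\ y\ge 0\}$, with $y\in\mathbb{R}^m$ a row vector. Put $A^+=(A,I)$, an $m\times(n+m)$ matrix with columns $A^+_j$, and $c^+=(c_1,\dots,c_n,0,\dots,0)\in\mathbb{R}^{n+m}$. The $n+m$ constraints of $(D)$ are $yA^+_j\ge c^+_j$, $j=1,\dots,n+m$. The dual feasible region is $D=\{y\in\mathbb{R}^m\mid yA^+_j\ge c^+_j,\ j=1,\dots,n+m\}$, and its points are called feasible points. An optimal point is a point of $D$ minimizing $yb$ over $D$. The $j$-th constraint plane, denoted $(\tau_j)$, is $\{y\mid yA^+_j=c^+_j\}$. It accepts a point $y$ if $yA^+_j\ge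 c^+_j$, and rejects (cuts off) $y$ otherwise. To say that a plane cuts off all feasible points means that it leaves no feasible point, i.e. the dual feasible region $D$ is empty. A base is a set of $m$ indices $\underline{B}\subset\{1,\dots,n+m\}$ such that the matrix $B$ formed by the columns $A^+_j$, $j\in\underline{B}$, has rank $m$; $c_B$ is the row vector of the corresponding entries of $c^+$. The associated cone is $C=\{y\in\mathbb{R}^m\mid yA^+_j\ge c^+_j,\ j\in\underline{B}\}$, with vertex $V=c_BB^{-1}$. In the Simplex table of the base $B$, the norm vector of the $j$-th plane is $\tau_j=(\tau_{1j},\dots,\tau_{mj})^T=B^{-1}A^+_j$, and its cutting degree with respect to $V$ is $c^{\wedge}_j=c^+_j-VA^+_j$. A constraint plane is called golden if it contains an optimal point. A constraint plane is called eliminatable if it is not golden. *)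

theory Defs
  imports "HOL-Analysis.Analysis"
begin

text \<open>
  For \<open>A :: real^'n^'m\<close> the number of rows is \<open>CARD('m)\<close> and the number of columns \<open>CARD('n)\<close>.
  The \<open>n + m\<close> constraints of the dual program are indexed by the type \<open>'n + 'm\<close>:
  \<open>Inl k\<close> is the \<open>k\<close>-th constraint of \<open>yA \<ge> c\<close>, and \<open>Inr i\<close> is the constraint \<open>y\<^sub>i \<ge> 0\<close>.
\<close>

definition A_plus :: "real^'n^'m \<Rightarrow> real^('n + 'm)^'m" where
  "A_plus A = (\<chi> i j. case j of Inl k \<Rightarrow> A $ i $ k | Inr k \<Rightarrow> mat 1 $ i $ k)"

definition c_plus :: "real^'n \<Rightarrow> real^('n + 'm::finite)" where
  "c_plus c = (\<chi> j. case j of Inl k \<Rightarrow> c $ k | Inr k \<Rightarrow> 0)"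

definition accepts :: "real^'n^'m \<Rightarrow> real^'n \<Rightarrow> 'n + 'm \<Rightarrow> real^'m \<Rightarrow> bool" where
  "accepts A c j y \<longleftrightarrow> y \<bullet> column j (A_plus A) \<ge> c_plus c $ j"

definition constraint_plane :: "real^'n^'m \<Rightarrow> real^'n \<Rightarrow> 'n + 'm \<Rightarrow> (real^'m) set" where
  "constraint_plane A c j = {y. y \<bullet> column j (A_plus A) = c_plus c $ j}"

definition dual_feasible :: "real^'n^'m \<Rightarrow> real^'n \<Rightarrow> (real^'m) set" where
  "dual_feasible A c = {y. \<forall>j. accepts A c j y}"

lemma dual_feasible_iff:
  "y \<in> dual_feasible A c \<longleftrightarrow> (\<forall>k. (y v* A) $ k \<ge> c $ k) \<and> (\<forall>i. y $ i \<ge> 0)"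
proof -
  have l: "accepts A c (Inl k) y \<longleftrightarrow> (y v* A) $ k \<ge> c $ k" for k
    by (simp add: accepts_def A_plus_def c_plus_def column_def inner_vec_def
        vector_matrix_mult_def mult.commute)
  have r: "accepts A c (Inr i) y \<longleftrightarrow> y $ i \<ge> 0" for i
    by (simp add: accepts_def A_plus_def c_plus_def column_def inner_vec_def mat_def
        if_distrib cong: if_cong)
  show ?thesis
    unfolding dual_feasible_def mem_Collect_eq
    by (metis l r sum.exhaust)
qed

definition dual_optimal :: "real^'n^'m \<Rightarrow> real^'m \<Rightarrow> real^'n \<Rightarrow> real^'m \<Rightarrow> bool" where
  "dual_optimal A b c y \<longleftrightarrow>
     y \<in> dual_feasible A c \<and> (\<forall>z \<in> dual_feasible A c. y \<bullet> b \<le> z \<bullet> b)"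

definition golden :: "real^'n^'m \<Rightarrow> real^'m \<Rightarrow> real^'n \<Rightarrow> 'n + 'm \<Rightarrow> bool" where
  "golden A b c j \<longleftrightarrow> (\<exists>y \<in> constraint_plane A c j. dual_optimal A b c y)"

definition eliminatable :: "real^'n^'m \<Rightarrow> real^'m \<Rightarrow> real^'n \<Rightarrow> 'n + 'm \<Rightarrow> bool" where
  "eliminatable A b c j \<longleftrightarrow> \<not> golden A b c j"

text \<open>
  A base is an unordered set of indices, while the rows of a Simplex table are numbered. The
  definitions belonging to a table therefore take an enumeration \<open>\<beta>\<close> of the base, that is,
  a bijection from the row indices \<open>'m\<close> onto it; row \<open>i\<close> of the table belongs to the base
  index \<open>\<beta> i\<close>.
\<close>

definition base_matrix :: "real^'n^'m \<Rightarrow> ('m \<Rightarrow> 'n + 'm) \<Rightarrow> real^'m^'m" where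
  "base_matrix A \<beta> = (\<chi> i k. A_plus A $ i $ \<beta> k)"

text \<open>The rank of a matrix is the dimension of the span of its set of columns, so the rank condition
  can be written without choosing an enumeration.\<close>

definition is_base :: "real^'n^'m \<Rightarrow> ('n + 'm) set \<Rightarrow> bool" where
  "is_base A S \<longleftrightarrow>
     card S = CARD('m) \<and> dim ((\<lambda>j. column j (A_plus A)) ` S) = CARD('m)"

lemma is_base_iff_rank:
  fixes A :: "real^'n^'m"
  assumes "bij_betw \<beta> UNIV S"
  shows "is_base A S \<longleftrightarrow> rank (base_matrix A \<beta>) = CARD('m)"
proof -
  have "columns (base_matrix A \<beta>) = (\<lambda>j. column j (A_plus A)) ` S"
    using assms
    by (auto simp: columns_def column_def base_matrix_def bij_betw_def)
  moreover have "card S = CARD('m)"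
    using assms by (metis bij_betw_same_card)
  ultimately show ?thesis
    by (simp add: is_base_def column_rank_def)
qed

definition base_costs :: "real^'n \<Rightarrow> ('m::finite \<Rightarrow> 'n + 'm) \<Rightarrow> real^'m" where
  "base_costs c \<beta> = (\<chi> k. c_plus c $ \<beta> k)"

definition cone_vertex :: "real^'n^'m \<Rightarrow> real^'n \<Rightarrow> ('m \<Rightarrow> 'n + 'm) \<Rightarrow> real^'m" where
  "cone_vertex A c \<beta> = base_costs c \<beta> v* matrix_inv (base_matrix A \<beta>)"

definition norm_vector :: "real^'n^'m \<Rightarrow> ('m \<Rightarrow> 'n + 'm) \<Rightarrow> 'n + 'm \<Rightarrow> real^'m" where
  "norm_vector A \<beta> j = matrix_inv (base_matrix A \<beta>) *v column j (A_plus A)"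

definition cutting_degree :: "real^'n^'m \<Rightarrow> real^'n \<Rightarrow> ('m \<Rightarrow> 'n + 'm) \<Rightarrow> 'n + 'm \<Rightarrow> real" where
  "cutting_degree A c \<beta> j = c_plus c $ j - cone_vertex A c \<beta> \<bullet> column j (A_plus A)"

end

theory Submission
  imports Defs
begin

text \<open>
  Write \<open>a\<close> for the \<open>j\<close>-th column of \<open>A\<^sup>+\<close> and \<open>s\<^sub>i\<close> for the slack of a point \<open>y\<close> in the \<open>i\<close>-th
  constraint of the base. Since the base matrix \<open>B\<close> is invertible, the norm vector \<open>\<tau> = B\<^sup>-\<^sup>1 a\<close>
  consists of the coordinates of \<open>a\<close> in the basis formed by the columns of \<open>B\<close>. All base
  constraints are tight at the cone vertex \<open>V\<close>, so expanding \<open>a\<close> in that basis shows that the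
  slack of any point \<open>y\<close> in the \<open>j\<close>-th constraint equals \<open>(\<Sum>i. \<tau>\<^sub>i * s\<^sub>i)\<close> minus the cutting
  degree (\<open>slack_eq_norm_vector_minus_cutting_degree\<close>).

  A feasible point has \<open>s\<^sub>i \<ge> 0\<close> for all \<open>i\<close>. If \<open>\<tau> \<ge> 0\<close> and the cutting degree is negative, its
  slack in constraint \<open>j\<close> is therefore strictly positive: the plane misses the whole feasible
  region, and in particular every optimal point. If \<open>\<tau> \<le> 0\<close> and the cutting degree is positive,
  the slack would be strictly negative, so that no feasible point exists.
\<close>

lemma invertible_base_matrix:
  fixes A :: "real^'n^'m"
  assumes "is_base A S" and "bij_betw \<beta> UNIV S"
  shows "invertible (base_matrix A \<beta>)"
proof -
  have "rank (base_matrix A \<beta>) = CARD('m)"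
    using assms is_base_iff_rank by blast
  then have "inj ((*v) (base_matrix A \<beta>))"
    by (simp add: full_rank_injective)
  then show ?thesis
    by (simp add: invertible_left_inverse matrix_left_invertible_injective)
qed

lemma vector_matrix_mult_base_matrix:
  "(y v* base_matrix A \<beta>) $ i = y \<bullet> column (\<beta> i) (A_plus A)"
  by (simp add: base_matrix_def column_def inner_vec_def vector_matrix_mult_def mult.commute)

lemma base_matrix_mult_norm_vector:
  assumes "invertible (base_matrix A \<beta>)"
  shows "base_matrix A \<beta> *v norm_vector A \<beta> j = column j (A_plus A)"
proof -
  have "base_matrix A \<beta> ** matrix_inv (base_matrix A \<beta>) = mat 1"
    using someI_ex[OF assms[unfolded invertible_def]] by (simp add: matrix_inv_def)
  then show ?thesis
    by (simp add: norm_vector_def matrix_vector_mul_assoc)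
qed

text \<open>
  Both \<open>y\<close> and the vertex can be moved across the inner product with the \<open>j\<close>-th column: \<open>y\<close> by
  writing the column as \<open>B \<tau>\<close>, the vertex because it is \<open>c\<^sub>B B\<^sup>-\<^sup>1\<close>. The two resulting inner
  products with \<open>\<tau>\<close> differ by the weighted sum of the base slacks.
\<close>

lemma slack_eq_norm_vector_minus_cutting_degree:
  fixes A :: "real^'n^'m"
  assumes "invertible (base_matrix A \<beta>)"
  shows "y \<bullet> column j (A_plus A) - c_plus c $ j =
    (\<Sum>i\<in>UNIV. norm_vector A \<beta> j $ i * (y \<bullet> column (\<beta> i) (A_plus A) - c_plus c $ \<beta> i))
      - cutting_degree A c \<beta> j"
proof -
  let ?B = "base_matrix A \<beta>" and ?\<tau> = "norm_vector A \<beta> j"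
  have y: "y \<bullet> column j (A_plus A) = (y v* ?B) \<bullet> ?\<tau>"
    using base_matrix_mult_norm_vector[OF assms, of j] by (simp add: dot_lmul_matrix)
  have V: "cone_vertex A c \<beta> \<bullet> column j (A_plus A) = base_costs c \<beta> \<bullet> ?\<tau>"
    by (simp add: cone_vertex_def norm_vector_def dot_lmul_matrix)
  have "y \<bullet> column j (A_plus A) - cone_vertex A c \<beta> \<bullet> column j (A_plus A)
      = (y v* ?B - base_costs c \<beta>) \<bullet> ?\<tau>"
    by (simp add: y V inner_diff_left)
  also have "\<dots> = (\<Sum>i\<in>UNIV. ?\<tau> $ i * (y \<bullet> column (\<beta> i) (A_plus A) - c_plus c $ \<beta> i))"
    by (simp add: inner_vec_def base_costs_def vector_matrix_mult_base_matrix mult.commute)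
  finally show ?thesis
    by (simp add: cutting_degree_def)
qed

lemma slack_nonneg_if_feasible:
  assumes "y \<in> dual_feasible A c"
  shows "0 \<le> y \<bullet> column k (A_plus A) - c_plus c $ k"
  using assms by (simp add: dual_feasible_def accepts_def)

theorem theorem4p1:
  fixes A :: "real^'n^'m"
    and b :: "real^'m"
    and c :: "real^'n"
    and S :: "('n + 'm) set"
    and \<beta> :: "'m \<Rightarrow> 'n + 'm"
    and j :: "'n + 'm"
  assumes b_nonneg: "\<forall>i. b $ i \<ge> 0"
    and base: "is_base A S"
    and enum: "bij_betw \<beta> UNIV S"
  shows "((\<forall>i. norm_vector A \<beta> j $ i \<ge> 0) \<and> cutting_degree A c \<beta> j < 0
            \<longrightarrow> eliminatable A b c j)
       \<and> ((\<forall>i. norm_vector A \<beta> j $ i \<le> 0) \<and> cutting_degree A c \<beta> j > 0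
            \<longrightarrow> dual_feasible A c = {})"
proof (intro conjI impI; elim conjE)
  let ?slack = "\<lambda>y k. y \<bullet> column k (A_plus A) - c_plus c $ k"
  note slack_eq = slack_eq_norm_vector_minus_cutting_degree
    [OF invertible_base_matrix[OF base enum], of _ j c]
  {
    assume \<tau>: "\<forall>i. norm_vector A \<beta> j $ i \<ge> 0" and deg: "cutting_degree A c \<beta> j < 0"
    have "y \<notin> constraint_plane A c j" if "y \<in> dual_feasible A c" for y
    proof -
      have "0 \<le> (\<Sum>i\<in>UNIV. norm_vector A \<beta> j $ i * ?slack y (\<beta> i))"
        using \<tau> slack_nonneg_if_feasible[OF that] by (intro sum_nonneg mult_nonneg_nonneg) auto
      with deg have "0 < ?slack y j"
        unfolding slack_eq by linarith
      then show ?thesis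
        by (simp add: constraint_plane_def)
    qed
    then show "eliminatable A b c j"
      by (auto simp: eliminatable_def golden_def dual_optimal_def)
  next
    assume \<tau>: "\<forall>i. norm_vector A \<beta> j $ i \<le> 0" and deg: "cutting_degree A c \<beta> j > 0"
    have False if "y \<in> dual_feasible A c" for y
    proof -
      have "(\<Sum>i\<in>UNIV. norm_vector A \<beta> j $ i * ?slack y (\<beta> i)) \<le> 0"
        using \<tau> slack_nonneg_if_feasible[OF that] by (intro sum_nonpos mult_nonpos_nonneg) auto
      with deg have "?slack y j < 0"
        unfolding slack_eq by linarith
      with slack_nonneg_if_feasible[OF that, of j] show False
        by linarith
    qed
    then show "dual_feasible A c = {}"
      by blast
  }
qed

end
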